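(* Let $(\mathcal T(n))_{n\in\mathbb N}$ be the triangle Markov chain obtained by iterated random barycentric subdivision started from an arbitrary triangle, and for each $n$ let $A_n$ be the largest angle of $\mathcal T(n)$, i.e. the angle at the vertex $(X_n,Y_n)$ of its normalized form, between the segments $[(X_n,Y_n),(0,0)]$ and $[(X_n,Y_n),(1,0)]$, where $(X_n,Y_n)$ is the characterizing point of $\mathcal T(n)$. Then for every $\epsilon>0$, $$\lim_{n\to\infty}\mathbb P[A_n<\pi-\epsilon]=0 .$$
   Context: A triangle is given by three points of the plane which are not all equal. Barycentric subdivision: if a triangle has vertices $A,B,C$, let $D,E,F$ be the midpoints of $[A,B],[B,C],[C,A]$ and $G$ its barycenter; the medians cut it into the six triangles $\{A,D,G\},\{D,B,G\},\{B,E,G\},\{E,C,G\},\{C,F,G\},\{F,A,G\}$. The triangle Markov chain: $\mathcal T(0)$ is given and $\mathcal T(n+1)$ is chosen uniformly among the six triangles of the barycentric subdivision of $\mathcal T(n)$, independently of the past. Characterizing point: there is a similitude mapping the triangle onto a triangle with vertices $(0,0)$, $(1,0)$, $(x,y)$, $0\le x\le1/2$, $y\ge0$, sending its longest edge onto $[(0,0),(1,0)]$ and its shortest edge onto $[(0,0),(x,y)]$; $(x,y)$ is unique and is the characterizing point; this image triangle is the normalized form. *)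

theory Defs
  imports "HOL-Probability.Probability"
begin

type_synonym triangle = "complex \<times> complex \<times> complex"

definition nondeg_triangle :: "triangle \<Rightarrow> bool" where
  "nondeg_triangle T = (case T of (A, B, C) \<Rightarrow> \<not> (A = B \<and> B = C))"

definition bary_child :: "triangle \<Rightarrow> nat \<Rightarrow> triangle" where
  "bary_child T i = (case T of (A, B, C) \<Rightarrow>
     (let D = (A + B) / 2; E = (B + C) / 2; F = (C + A) / 2; G = (A + B + C) / 3 in
      if i = 0 then (A, D, G) else if i = 1 then (D, B, G) else if i = 2 then (B, E, G)
      else if i = 3 then (E, C, G) else if i = 4 then (C, F, G) else (F, A, G)))"

definition bary_step :: "triangle \<Rightarrow> triangle pmf" where
  "bary_step T = map_pmf (bary_child T) (pmf_of_set {0..<6})"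

primrec tri_chain :: "triangle \<Rightarrow> nat \<Rightarrow> triangle pmf" where
  "tri_chain T0 0 = return_pmf T0"
| "tri_chain T0 (Suc n) = bind_pmf (tri_chain T0 n) bary_step"

definition similitude :: "(complex \<Rightarrow> complex) \<Rightarrow> bool" where
  "similitude f = (\<exists>a b. a \<noteq> 0 \<and> ((\<forall>z. f z = a * z + b) \<or> (\<forall>z. f z = a * cnj z + b)))"

definition is_char_point :: "triangle \<Rightarrow> complex \<Rightarrow> bool" where
  "is_char_point T p = (0 \<le> Re p \<and> Re p \<le> 1/2 \<and> 0 \<le> Im p \<and>
     (\<exists>P Q R f. (case T of (A, B, C) \<Rightarrow>
          (P, Q, R) \<in> {(A, B, C), (A, C, B), (B, A, C), (B, C, A), (C, A, B), (C, B, A)}) \<and>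
        dist P Q \<ge> dist Q R \<and> dist Q R \<ge> dist P R \<and>
        similitude f \<and> f P = 0 \<and> f Q = 1 \<and> f R = p))"

definition char_point :: "triangle \<Rightarrow> complex" where
  "char_point T = (THE p. is_char_point T p)"

definition vertex_angle :: "complex \<Rightarrow> complex \<Rightarrow> complex \<Rightarrow> real" where
  "vertex_angle v u w =
     arccos (((u - v) \<bullet> (w - v)) / (norm (u - v) * norm (w - v)))"

definition largest_angle :: "triangle \<Rightarrow> real" where
  "largest_angle T = vertex_angle (char_point T) 0 1"

end

theory Submission
  imports Defs
begin

text \<open>
  An edge of the triangle at time n is an integer combination of the vertices of the initial
  triangle, divided by 6 to the power n, and the coefficients of an edge perform a random walk: a
  uniform permutation followed by a fixed linear map. A height of coefficients that is invariant
  under permutations expands if the product of its values after the six possible steps beats the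
  sixth power of the deterministic rate. A second-order expansion shows that a small negative
  power of such a height, normalised by the rate, contracts in expectation, so that the height of
  an edge is unlikely to stay below its deterministic rate.

  The largest angle stays away from \<open>\<pi>\<close> only if the square of some edge is at most a constant times
  the area, and the area at time n is deterministic. If the initial triangle has positive area, the
  height is the squared norm of the coefficients. If the initial triangle is flat, the edge must
  vanish, so its coefficients lie on a fixed rational line; the height is then the squared norm
  divided by the square of the gcd, which is constant on that line. It expands because the gcd
  gained by primitive coefficients in one step divides 6 and is rarely 6: the product of the six
  gains is at most 36.
\<close>

section \<open>Contraction of negative powers\<close>

lemma exp_le_quadratic:
  fixes x :: real
  assumes "\<bar>x\<bar> \<le> 1/2"
  shows "exp x \<le> 1 + x + 2 * x\<^sup>2"
proof -
  have pos: "0 < 1 - x" using assms by linarith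
  have "exp x = 1 / exp (- x)" by (simp add: exp_minus field_simps)
  also have "\<dots> \<le> 1 / (1 - x)"
    using exp_ge_add_one_self[of "- x"] pos by (intro divide_left_mono) auto
  also have "\<dots> \<le> 1 + x + 2 * x\<^sup>2"
  proof -
    have "0 \<le> x\<^sup>2 * (1 - 2 * x)" using assms by (intro mult_nonneg_nonneg) auto
    then show ?thesis using pos by (simp add: field_simps power2_eq_square)
  qed
  finally show ?thesis .
qed

lemma ln_prod_list:
  fixes xs :: "real list"
  assumes "0 \<notin> set xs"
  shows "ln (prod_list xs) = (\<Sum>x\<leftarrow>xs. ln x)"
  using assms by (induction xs) (simp_all add: ln_mult prod_list_zero_iff)

lemma sum_list_powr_minus_le:
  fixes L s :: real
  assumes s: "0 \<le> s" "s * L \<le> 1/2"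
    and xs: "\<And>x. x \<in> set xs \<Longrightarrow> 0 < x \<and> \<bar>ln x\<bar> \<le> L"
  shows "(\<Sum>x\<leftarrow>xs. x powr - s) \<le> length xs * (1 + 2 * (s * L)\<^sup>2) - s * ln (prod_list xs)"
proof -
  have nonzero: "0 \<notin> set xs" using xs by blast
  have "x powr - s \<le> (1 + 2 * (s * L)\<^sup>2) - s * ln x" if "x \<in> set xs" for x
  proof -
    have exponent_le: "\<bar>s * ln x\<bar> \<le> s * L"
      using xs[OF that] s(1) by (simp add: abs_mult mult_left_mono)
    have "x powr - s = exp (- (s * ln x))" using xs[OF that] by (simp add: powr_def)
    also have "\<dots> \<le> 1 - s * ln x + 2 * (s * ln x)\<^sup>2"
      using exp_le_quadratic[of "- (s * ln x)"] exponent_le s(2) by simp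
    also have "(s * ln x)\<^sup>2 \<le> (s * L)\<^sup>2"
      using exponent_le by (metis abs_ge_zero power2_abs power_mono)
    finally show ?thesis by simp
  qed
  then have "(\<Sum>x\<leftarrow>xs. x powr - s) \<le> (\<Sum>x\<leftarrow>xs. (1 + 2 * (s * L)\<^sup>2) - s * ln x)"
    by (rule sum_list_mono)
  also have "\<dots> = length xs * (1 + 2 * (s * L)\<^sup>2) - s * ln (prod_list xs)"
    using nonzero by (simp add: sum_list_subtractf sum_list_const_mult sum_list_triv ln_prod_list)
  finally show ?thesis .
qed

lemma abs_ln_le_ln:
  fixes x K :: real
  assumes "1 < K" "1 / K \<le> x" "x \<le> K"
  shows "0 < x" "\<bar>ln x\<bar> \<le> ln K"
proof -
  show "0 < x" using assms by (smt (verit) zero_less_divide_1_iff)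
  then have "ln (1 / K) \<le> ln x" "ln x \<le> ln K" using assms by simp_all
  then show "\<bar>ln x\<bar> \<le> ln K" using assms(1) by (simp add: ln_div abs_le_iff)
qed

lemma sum_list_powr_minus_contraction:
  fixes K \<gamma> :: real
  assumes "1 < K" "1 < \<gamma>" "0 < m"
  obtains s \<rho> :: real where "0 < s" "0 \<le> \<rho>" "\<rho> < 1"
    "\<And>xs. \<lbrakk>length xs = m; set xs \<subseteq> {1 / K..K}; \<gamma> \<le> prod_list xs\<rbrakk>
       \<Longrightarrow> (\<Sum>x\<leftarrow>xs. x powr - s) \<le> m * \<rho>"
proof -
  define L where "L = ln K"
  \<comment> \<open>The quadratic error \<open>2 * m * (s * L)\<^sup>2\<close> may use up only half of the gain \<open>s * ln \<gamma>\<close>.\<close>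
  define s where "s = min (1 / (2 * L)) (ln \<gamma> / (4 * m * L\<^sup>2))"
  define \<rho> where "\<rho> = max 0 (1 - s * ln \<gamma> / (2 * m))"
  have L_pos: "0 < L" and gain_pos: "0 < ln \<gamma>" using assms by (simp_all add: L_def)
  have s_pos: "0 < s" using L_pos gain_pos assms(3) by (simp add: s_def)
  have "s * L \<le> 1 / (2 * L) * L" using L_pos by (intro mult_right_mono) (auto simp: s_def)
  then have s_small: "s * L \<le> 1/2" using L_pos by simp
  have "s * (4 * m * L\<^sup>2) \<le> ln \<gamma> / (4 * m * L\<^sup>2) * (4 * m * L\<^sup>2)"
    by (intro mult_right_mono) (auto simp: s_def)
  then have "s * (4 * m * L\<^sup>2) \<le> ln \<gamma>" using L_pos assms(3) by simp
  then have "s * (s * (4 * m * L\<^sup>2)) \<le> s * ln \<gamma>" using s_pos by simp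
  then have error_le: "2 * m * (s * L)\<^sup>2 \<le> s * ln \<gamma> / 2"
    by (simp add: power2_eq_square algebra_simps)
  show thesis
  proof (rule that[of s \<rho>])
    have "0 < s * ln \<gamma> / (2 * m)" using s_pos gain_pos assms(3) by simp
    then show "0 < s" "0 \<le> \<rho>" "\<rho> < 1" using s_pos by (simp_all add: \<rho>_def)
    fix xs :: "real list"
    assume length_eq: "length xs = m" and bounds: "set xs \<subseteq> {1 / K..K}"
      and prod_ge: "\<gamma> \<le> prod_list xs"
    have "0 < x \<and> \<bar>ln x\<bar> \<le> L" if "x \<in> set xs" for x
      using abs_ln_le_ln[OF assms(1), of x] bounds that by (auto simp: L_def)
    then have "(\<Sum>x\<leftarrow>xs. x powr - s) \<le> m * (1 + 2 * (s * L)\<^sup>2) - s * ln (prod_list xs)"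
      using sum_list_powr_minus_le[of s L xs] s_pos s_small length_eq by simp
    also have "\<dots> \<le> m * (1 + 2 * (s * L)\<^sup>2) - s * ln \<gamma>"
      using s_pos prod_ge assms(2) by simp
    also have "\<dots> \<le> m * (1 - s * ln \<gamma> / (2 * m))"
      using error_le assms(3) by (simp add: distrib_left right_diff_distrib)
    also have "\<dots> \<le> m * \<rho>"
      by (intro mult_left_mono) (auto simp: \<rho>_def)
    finally show "(\<Sum>x\<leftarrow>xs. x powr - s) \<le> m * \<rho>" .
  qed
qed

section \<open>Edges as integer combinations of the initial vertices\<close>

type_synonym weights = "int \<times> int \<times> int"

text \<open>
  The order of the list is chosen so that the first child of the \<open>i\<close>-th ordering is the \<open>i\<close>-th child
  of the original triangle, up to the order of its vertices.
\<close>

fun orderings :: "'a \<times> 'a \<times> 'a \<Rightarrow> ('a \<times> 'a \<times> 'a) list" where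
  "orderings (a, b, c) = [(a, b, c), (b, a, c), (b, c, a), (c, b, a), (c, a, b), (a, c, b)]"

lemma length_orderings [simp]: "length (orderings w) = 6"
  by (cases w) simp

lemma mset_orderings: "v \<in> set (orderings w) \<Longrightarrow> mset (orderings v) = mset (orderings w)"
  by (cases w) auto

lemma sum_list_orderings_cong:
  fixes f :: "'a \<times> 'a \<times> 'a \<Rightarrow> 'b :: comm_monoid_add"
  assumes "v \<in> set (orderings w)"
  shows "(\<Sum>u\<leftarrow>orderings v. f u) = (\<Sum>u\<leftarrow>orderings w. f u)"
  unfolding sum_mset_sum_list[symmetric] mset_map mset_orderings[OF assms] ..

fun lin_comb :: "weights \<Rightarrow> triangle \<Rightarrow> complex" where
  "lin_comb (a, b, c) (A, B, C) = of_int a * A + of_int b * B + of_int c * C"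

lemma sum_list_lin_comb_orderings:
  fixes h :: "complex \<Rightarrow> 'a :: comm_monoid_add"
  shows "(\<Sum>S\<leftarrow>orderings T. h (lin_comb w S)) = (\<Sum>v\<leftarrow>orderings w. h (lin_comb v T))"
  by (cases w; cases T) (simp add: add_ac)

fun first_child :: "triangle \<Rightarrow> triangle" where
  "first_child (A, B, C) = (A, (A + B) / 2, (A + B + C) / 3)"

lemma bary_child_ordering:
  assumes "i < 6"
  shows "bary_child T i \<in> set (orderings (first_child (orderings T ! i)))"
proof -
  have "i \<in> {0, 1, 2, 3, 4, 5}" using assms by auto
  then show ?thesis
    by (cases T) (auto simp: bary_child_def Let_def add_ac)
qed

fun refine :: "weights \<Rightarrow> weights" where
  "refine (a, b, c) = (6 * a + 3 * b + 2 * c, 3 * b + 2 * c, 2 * c)"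

lemma lin_comb_first_child: "6 * lin_comb w (first_child T) = lin_comb (refine w) T"
  by (cases w; cases T) (simp add: field_simps)

lemma sum_list_swap:
  fixes f :: "'a \<Rightarrow> 'b \<Rightarrow> 'c :: comm_monoid_add"
  shows "(\<Sum>x\<leftarrow>xs. \<Sum>y\<leftarrow>ys. f x y) = (\<Sum>y\<leftarrow>ys. \<Sum>x\<leftarrow>xs. f x y)"
  by (induction xs) (simp_all add: sum_list_addf)

lemma sum_lin_comb_bary_child:
  fixes h :: "complex \<Rightarrow> 'a :: comm_monoid_add"
  shows "(\<Sum>i<6. \<Sum>S\<leftarrow>orderings (bary_child T i). h (6 * lin_comb w S)) =
    (\<Sum>v\<leftarrow>orderings w. \<Sum>S\<leftarrow>orderings T. h (lin_comb (refine v) S))"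
proof -
  have "(\<Sum>i<6. \<Sum>S\<leftarrow>orderings (bary_child T i). h (6 * lin_comb w S)) =
      (\<Sum>i<6. \<Sum>S\<leftarrow>orderings (first_child (orderings T ! i)). h (6 * lin_comb w S))"
    by (intro sum.cong refl sum_list_orderings_cong bary_child_ordering) simp
  also have "\<dots> = (\<Sum>S\<leftarrow>orderings T. \<Sum>S'\<leftarrow>orderings (first_child S). h (6 * lin_comb w S'))"
    by (simp add: sum_list_sum_nth atLeast0LessThan)
  also have "\<dots> = (\<Sum>S\<leftarrow>orderings T. \<Sum>v\<leftarrow>orderings w. h (lin_comb (refine v) S))"
    by (simp add: sum_list_lin_comb_orderings[where h = "\<lambda>z. h (6 * z)"] lin_comb_first_child)
  finally show ?thesis
    by (subst sum_list_swap)
qed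

fun edge_weights :: "weights \<Rightarrow> bool" where
  "edge_weights (a, b, c) \<longleftrightarrow> a + b + c = 0 \<and> (a, b, c) \<noteq> (0, 0, 0)"

lemma edge_weights_ordering: "edge_weights w \<Longrightarrow> v \<in> set (orderings w) \<Longrightarrow> edge_weights v"
  by (cases w) auto

lemma edge_weights_refine: "edge_weights w \<Longrightarrow> edge_weights (refine w)"
  by (cases w) auto

section \<open>Expectations along the chain\<close>

lemma integral_sum_list:
  fixes f :: "'b \<Rightarrow> 'a \<Rightarrow> 'c :: {banach, second_countable_topology}"
  assumes "\<And>x. x \<in> set xs \<Longrightarrow> integrable M (f x)"
  shows "(\<integral>y. (\<Sum>x\<leftarrow>xs. f x y) \<partial>M) = (\<Sum>x\<leftarrow>xs. \<integral>y. f x y \<partial>M)"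
  using assms by (simp add: sum_list_sum_nth)

lemma prob_tendsto_zero_mono_on_support:
  fixes p :: "nat \<Rightarrow> 'a pmf"
  assumes lim: "(\<lambda>n. measure_pmf.prob (p n) (B n)) \<longlonglongrightarrow> 0"
    and subset: "\<And>n. A n \<inter> set_pmf (p n) \<subseteq> B n"
  shows "(\<lambda>n. measure_pmf.prob (p n) (A n)) \<longlonglongrightarrow> 0"
proof (rule tendsto_sandwich[OF _ _ tendsto_const lim])
  have "measure_pmf.prob (p n) (A n) \<le> measure_pmf.prob (p n) (B n)" for n
    using subset
    by (subst measure_Int_set_pmf[symmetric]) (simp add: measure_pmf.finite_measure_mono)
  then show "\<forall>\<^sub>F n in sequentially. measure_pmf.prob (p n) (A n) \<le> measure_pmf.prob (p n) (B n)"
    by simp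
qed simp

lemma finite_set_tri_chain: "finite (set_pmf (tri_chain T n))"
  by (induction n) (auto simp: bary_step_def set_pmf_of_set)

lemma integrable_tri_chain: "integrable (measure_pmf (tri_chain T n)) (f :: triangle \<Rightarrow> real)"
  by (rule integrable_measure_pmf_finite[OF finite_set_tri_chain])

lemma expectation_bary_step:
  fixes f :: "triangle \<Rightarrow> real"
  shows "measure_pmf.expectation (bary_step T) f = (\<Sum>i<6. f (bary_child T i)) / 6"
  by (simp add: bary_step_def integral_pmf_of_set lessThan_atLeast0)

lemma expectation_tri_chain_Suc:
  fixes f :: "triangle \<Rightarrow> real"
  shows "measure_pmf.expectation (tri_chain T (Suc n)) f =
    measure_pmf.expectation (tri_chain T n) (\<lambda>U. (\<Sum>i<6. f (bary_child U i)) / 6)"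
proof -
  have finite_step: "finite (set_pmf (bary_step U))" for U
    by (simp add: bary_step_def)
  show ?thesis
    unfolding tri_chain.simps
    by (subst pmf_expectation_bind[OF finite_set_tri_chain finite_step subset_refl])
       (simp add: expectation_bary_step integral_measure_pmf[OF finite_set_tri_chain]
         flip: sum_divide_distrib)
qed

lemma expectation_edges_le:
  fixes V :: "weights \<Rightarrow> real"
  assumes step: "\<And>w. edge_weights w \<Longrightarrow> (\<Sum>v\<leftarrow>orderings w. V (refine v)) \<le> 6 * \<rho> * V w"
    and base: "\<And>w. edge_weights w \<Longrightarrow> (\<Sum>S\<leftarrow>orderings T. h (lin_comb w S)) \<le> C * V w"
    and nonneg: "0 \<le> C" "0 \<le> \<rho>"
    and "edge_weights w"
  shows "measure_pmf.expectation (tri_chain T n) (\<lambda>U. \<Sum>S\<leftarrow>orderings U. h (6 ^ n * lin_comb w S))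
    \<le> C * \<rho> ^ n * V w"
  using \<open>edge_weights w\<close>
proof (induction n arbitrary: w)
  case 0
  then show ?case using base by simp
next
  case (Suc n)
  let ?E = "measure_pmf.expectation (tri_chain T n)"
  let ?S = "\<lambda>w U. \<Sum>S\<leftarrow>orderings U. h (6 ^ n * lin_comb w S)"
  have "measure_pmf.expectation (tri_chain T (Suc n))
        (\<lambda>U. \<Sum>S\<leftarrow>orderings U. h (6 ^ Suc n * lin_comb w S))
      = ?E (\<lambda>U. (\<Sum>v\<leftarrow>orderings w. ?S (refine v) U) / 6)"
    unfolding expectation_tri_chain_Suc
      sum_lin_comb_bary_child[where h = "\<lambda>z. h (6 ^ n * z)", symmetric]
    by (simp add: mult_ac)
  also have "\<dots> = (\<Sum>v\<leftarrow>orderings w. ?E (?S (refine v))) / 6"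
    by (simp add: integral_sum_list[OF integrable_tri_chain])
  also have "\<dots> \<le> (\<Sum>v\<leftarrow>orderings w. C * \<rho> ^ n * V (refine v)) / 6"
    using Suc.prems edge_weights_ordering edge_weights_refine
    by (intro divide_right_mono sum_list_mono Suc.IH) auto
  also have "\<dots> = C * \<rho> ^ n * ((\<Sum>v\<leftarrow>orderings w. V (refine v)) / 6)"
    by (simp add: sum_list_const_mult)
  also have "\<dots> \<le> C * \<rho> ^ n * (\<rho> * V w)"
    using step[OF Suc.prems] nonneg by (intro mult_left_mono) auto
  finally show ?case by (simp add: mult_ac)
qed

lemma prob_Bex_orderings_le:
  "measure_pmf.prob (tri_chain T n) {U. \<exists>S\<in>set (orderings U). P S}
    \<le> measure_pmf.expectation (tri_chain T n) (\<lambda>U. \<Sum>S\<leftarrow>orderings U. of_bool (P S))"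
proof -
  have "indicator {U. \<exists>S\<in>set (orderings U). P S} U \<le> (\<Sum>S\<leftarrow>orderings U. of_bool (P S) :: real)"
    for U
  proof (cases "\<exists>S\<in>set (orderings U). P S")
    case True
    then have "1 \<in> set (map (\<lambda>S. of_bool (P S) :: real) (orderings U))" by force
    then have "1 \<le> (\<Sum>S\<leftarrow>orderings U. of_bool (P S) :: real)"
      by (rule member_le_sum_list) auto
    then show ?thesis using True by simp
  next
    case False
    then show ?thesis by (auto intro!: sum_list_nonneg)
  qed
  then have "measure_pmf.expectation (tri_chain T n) (indicator {U. \<exists>S\<in>set (orderings U). P S})
      \<le> measure_pmf.expectation (tri_chain T n) (\<lambda>U. \<Sum>S\<leftarrow>orderings U. of_bool (P S) :: real)"
    by (intro integral_mono integrable_tri_chain)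
  then show ?thesis by simp
qed

section \<open>Expanding heights\<close>

locale expanding_height =
  fixes H :: "weights \<Rightarrow> real" and \<mu> K \<gamma> :: real
  assumes rates: "0 < \<mu>" "1 < K" "1 < \<gamma>"
    and height_pos: "edge_weights w \<Longrightarrow> 0 < H w"
    and height_ordering: "edge_weights w \<Longrightarrow> v \<in> set (orderings w) \<Longrightarrow> H v = H w"
    and height_refine_ge: "edge_weights w \<Longrightarrow> \<mu> * H w \<le> K * H (refine w)"
    and height_refine_le: "edge_weights w \<Longrightarrow> H (refine w) \<le> K * (\<mu> * H w)"
    and prod_height_refine_ge:
      "edge_weights w \<Longrightarrow> \<gamma> * (\<mu> * H w) ^ 6 \<le> (\<Prod>v\<leftarrow>orderings w. H (refine v))"
begin

lemma height_refine_ratio_bounds: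
  assumes w: "edge_weights w" and v: "v \<in> set (orderings w)"
  shows "H (refine v) / (\<mu> * H w) \<in> {1 / K..K}"
proof -
  have v_weights: "edge_weights v" and height_eq: "H v = H w"
    using edge_weights_ordering[OF w v] height_ordering[OF w v] by simp_all
  define M where "M = \<mu> * H w"
  have "0 < M" using height_pos[OF w] rates by (simp add: M_def)
  then show ?thesis
    using height_refine_ge[OF v_weights] height_refine_le[OF v_weights] rates
    unfolding height_eq M_def[symmetric] by (simp add: field_simps)
qed

lemma height_powr_minus_contraction:
  obtains s \<rho> :: real where "0 < s" "0 \<le> \<rho>" "\<rho> < 1"
    "\<And>w. edge_weights w \<Longrightarrow>
       (\<Sum>v\<leftarrow>orderings w. H (refine v) powr - s) \<le> 6 * (\<mu> powr - s * \<rho>) * H w powr - s"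
proof -
  obtain s \<rho> :: real where s_\<rho>: "0 < s" "0 \<le> \<rho>" "\<rho> < 1" and contraction:
    "\<And>xs. \<lbrakk>length xs = 6; set xs \<subseteq> {1 / K..K}; \<gamma> \<le> prod_list xs\<rbrakk>
       \<Longrightarrow> (\<Sum>x\<leftarrow>xs. x powr - s) \<le> real 6 * \<rho>"
    using rates sum_list_powr_minus_contraction[of K \<gamma> 6] by (metis zero_less_numeral)
  show thesis
  proof (rule that[OF s_\<rho>])
    fix w assume w: "edge_weights w"
    define M where "M = \<mu> * H w"
    define xs where "xs = map (\<lambda>v. H (refine v) / M) (orderings w)"
    have M_pos: "0 < M" using height_pos[OF w] rates by (simp add: M_def)
    have refine_pos: "0 < H (refine v)" if "v \<in> set (orderings w)" for v
      using edge_weights_ordering[OF w that] by (intro height_pos edge_weights_refine)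
    have "prod_list xs = (\<Prod>v\<leftarrow>orderings w. H (refine v)) / M ^ 6"
      by (cases w) (simp add: xs_def eval_nat_numeral)
    then have "\<gamma> \<le> prod_list xs"
      using prod_height_refine_ge[OF w] M_pos by (simp add: M_def[symmetric] le_divide_eq)
    moreover have "set xs \<subseteq> {1 / K..K}" "length xs = 6"
      using height_refine_ratio_bounds[OF w] by (auto simp: xs_def M_def)
    ultimately have "M powr - s * (\<Sum>x\<leftarrow>xs. x powr - s) \<le> M powr - s * (real 6 * \<rho>)"
      by (intro mult_left_mono contraction) auto
    also have "M powr - s * (\<Sum>x\<leftarrow>xs. x powr - s) =
        (\<Sum>v\<leftarrow>orderings w. M powr - s * (H (refine v) / M) powr - s)"
      by (simp add: xs_def sum_list_const_mult o_def)
    also have "\<dots> = (\<Sum>v\<leftarrow>orderings w. H (refine v) powr - s)"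
      using refine_pos M_pos
      by (intro arg_cong[where f = sum_list] map_cong refl) (simp add: powr_divide)
    also have "M powr - s * (real 6 * \<rho>) = 6 * (\<mu> powr - s * \<rho>) * H w powr - s"
      using height_pos[OF w] rates by (simp add: M_def powr_mult)
    finally show
      "(\<Sum>v\<leftarrow>orderings w. H (refine v) powr - s) \<le> 6 * (\<mu> powr - s * \<rho>) * H w powr - s" .
  qed
qed

lemma count_orderings_le_height_powr:
  assumes w: "edge_weights w" and "0 \<le> s"
    and bounded: "\<And>v. edge_weights v \<Longrightarrow> lin_comb v T \<in> B \<Longrightarrow> H v \<le> L"
  shows "(\<Sum>S\<leftarrow>orderings T. of_bool (lin_comb w S \<in> B)) \<le> 6 * L powr s * H w powr - s"
proof -
  have single: "of_bool (lin_comb v T \<in> B) \<le> L powr s * H v powr - s" if "edge_weights v" for v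
  proof (cases "lin_comb v T \<in> B")
    case True
    have "H v powr s \<le> L powr s"
      using bounded[OF that True] height_pos[OF that] \<open>0 \<le> s\<close> by (intro powr_mono2) auto
    then show ?thesis using True height_pos[OF that] by (simp add: powr_minus field_simps)
  qed simp
  have "(\<Sum>S\<leftarrow>orderings T. of_bool (lin_comb w S \<in> B)) =
      (\<Sum>v\<leftarrow>orderings w. of_bool (lin_comb v T \<in> B) :: real)"
    by (rule sum_list_lin_comb_orderings)
  also have "\<dots> \<le> (\<Sum>v\<leftarrow>orderings w. L powr s * H w powr - s)"
    using single edge_weights_ordering[OF w] height_ordering[OF w] by (intro sum_list_mono) metis
  finally show ?thesis by (simp add: sum_list_triv)
qed

lemma prob_lin_comb_tendsto_zero:
  fixes B :: "nat \<Rightarrow> complex set"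
  assumes w: "edge_weights w" and L: "0 < L"
    and bounded: "\<And>n v. edge_weights v \<Longrightarrow> lin_comb v T \<in> B n \<Longrightarrow> H v \<le> L * \<mu> ^ n"
  shows "(\<lambda>n. measure_pmf.prob (tri_chain T n)
      {U. \<exists>S\<in>set (orderings U). 6 ^ n * lin_comb w S \<in> B n}) \<longlonglongrightarrow> 0"
proof -
  obtain s \<rho> :: real where s_\<rho>: "0 < s" "0 \<le> \<rho>" "\<rho> < 1" and contraction: "\<And>w. edge_weights w \<Longrightarrow>
      (\<Sum>v\<leftarrow>orderings w. H (refine v) powr - s) \<le> 6 * (\<mu> powr - s * \<rho>) * H w powr - s"
    by (rule height_powr_minus_contraction) blast
  define C where "C = 6 * L powr s * H w powr - s"
  have rates_cancel: "(L * \<mu> ^ n) powr s * (\<mu> powr - s * \<rho>) ^ n = L powr s * \<rho> ^ n" for n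
  proof -
    have "(\<mu> ^ n) powr s = (\<mu> powr s) ^ n"
      using rates by (simp add: powr_power powr_powr mult.commute flip: powr_realpow)
    then show ?thesis
      using L rates by (simp add: powr_mult powr_minus power_mult_distrib power_inverse)
  qed
  have "measure_pmf.prob (tri_chain T n) {U. \<exists>S\<in>set (orderings U). 6 ^ n * lin_comb w S \<in> B n}
      \<le> C * \<rho> ^ n" for n
  proof -
    have "measure_pmf.prob (tri_chain T n) {U. \<exists>S\<in>set (orderings U). 6 ^ n * lin_comb w S \<in> B n}
      \<le> measure_pmf.expectation (tri_chain T n)
          (\<lambda>U. \<Sum>S\<leftarrow>orderings U. of_bool (6 ^ n * lin_comb w S \<in> B n))"
      by (rule prob_Bex_orderings_le)
    also have "\<dots> \<le> 6 * (L * \<mu> ^ n) powr s * (\<mu> powr - s * \<rho>) ^ n * H w powr - s"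
      by (rule expectation_edges_le[where h = "\<lambda>z. of_bool (z \<in> B n)" and V = "\<lambda>w. H w powr - s",
            OF contraction count_orderings_le_height_powr]) (use w s_\<rho> bounded in auto)
    also have "\<dots> = C * \<rho> ^ n"
      using rates_cancel by (simp add: C_def mult_ac)
    finally show ?thesis .
  qed
  then show ?thesis
    by (intro tendsto_sandwich[OF _ _ tendsto_const
          tendsto_mult_right_zero[OF LIMSEQ_realpow_zero[OF s_\<rho>(2,3)]]])
      (auto intro: always_eventually)
qed

end

section \<open>The squared norm\<close>

fun sqnorm :: "weights \<Rightarrow> int" where
  "sqnorm (a, b, c) = a\<^sup>2 + b\<^sup>2 + c\<^sup>2"

lemma sqnorm_ordering: "v \<in> set (orderings w) \<Longrightarrow> sqnorm v = sqnorm w"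
  by (cases w) auto

lemma sqnorm_pos: "edge_weights w \<Longrightarrow> 0 < sqnorm w"
  by (cases w) (auto simp: add_pos_nonneg add_nonneg_pos)

lemma sqnorm_refine:
  assumes "a + b + c = 0"
  shows "sqnorm (refine (a, b, c)) = 6 * (3 * a\<^sup>2 + c\<^sup>2)"
proof -
  have b_eq: "b = - a - c" using assms by simp
  show ?thesis by (simp add: b_eq power2_eq_square algebra_simps)
qed

lemma sqnorm_refine_ge:
  assumes "edge_weights w"
  shows "2 * sqnorm w \<le> sqnorm (refine w)"
proof -
  obtain a b c where w_eq: "w = (a, b, c)" and sum_eq_0: "a + b + c = 0"
    using assms by (cases w) simp
  have b_eq: "b = - a - c" using sum_eq_0 by simp
  have "sqnorm (refine w) = 2 * sqnorm w + (12 * a\<^sup>2 + 2 * (a - c)\<^sup>2)"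
    unfolding w_eq sqnorm_refine[OF sum_eq_0] by (simp add: b_eq power2_eq_square algebra_simps)
  then show ?thesis by simp
qed

lemma sqnorm_refine_le:
  assumes "edge_weights w"
  shows "sqnorm (refine w) \<le> 18 * sqnorm w"
proof -
  obtain a b c where w_eq: "w = (a, b, c)" and sum_eq_0: "a + b + c = 0"
    using assms by (cases w) simp
  show ?thesis unfolding w_eq sqnorm_refine[OF sum_eq_0] by simp
qed

lemma prod_sqnorm_refine_ge:
  assumes "edge_weights w"
  shows "9 * (6 * sqnorm w) ^ 6 \<le> 4 * (\<Prod>v\<leftarrow>orderings w. sqnorm (refine v))"
proof -
  obtain a b c where w_eq: "w = (a, b, c)" and sum_eq_0: "a + b + c = 0"
    using assms by (cases w) simp
  have c_eq: "c = - a - b" using sum_eq_0 by simp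
  have permuted_sums: "b + a + c = 0" "b + c + a = 0" "c + b + a = 0" "c + a + b = 0" "a + c + b = 0"
    using sum_eq_0 by simp_all
  \<comment> \<open>\<open>- q\<close> and \<open>r\<close> are the elementary symmetric polynomials of degree 2 and 3 in \<open>a, b, c\<close>.\<close>
  define q where "q = a\<^sup>2 + a * b + b\<^sup>2"
  define r where "r = a * b * c"
  have sqnorm_eq: "sqnorm w = 2 * q"
    by (simp add: w_eq c_eq q_def power2_eq_square algebra_simps)
  then have "0 < q" using sqnorm_pos[OF assms] by simp
  have factor_out: "6 * p1 * (6 * p2 * (6 * p3 * (6 * p4 * (6 * p5 * (6 * p6))))) =
      6 ^ 6 * (p1 * p2 * p3 * p4 * p5 * p6)" for p1 p2 p3 p4 p5 p6 :: int
    by simp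
  have "(\<Prod>v\<leftarrow>orderings w. sqnorm (refine v)) =
      6 * (3 * a\<^sup>2 + c\<^sup>2) * (6 * (3 * b\<^sup>2 + c\<^sup>2) * (6 * (3 * b\<^sup>2 + a\<^sup>2) *
        (6 * (3 * c\<^sup>2 + a\<^sup>2) * (6 * (3 * c\<^sup>2 + b\<^sup>2) * (6 * (3 * a\<^sup>2 + b\<^sup>2))))))"
    by (simp only: w_eq orderings.simps list.map prod_list.Cons prod_list.Nil mult_1_right
        sqnorm_refine sum_eq_0 permuted_sums)
  also have "\<dots> = 6 ^ 6 * ((3 * a\<^sup>2 + c\<^sup>2) * (3 * b\<^sup>2 + c\<^sup>2) * (3 * b\<^sup>2 + a\<^sup>2) *
        (3 * c\<^sup>2 + a\<^sup>2) * (3 * c\<^sup>2 + b\<^sup>2) * (3 * a\<^sup>2 + b\<^sup>2))"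
    by (rule factor_out)
  also have "(3 * a\<^sup>2 + c\<^sup>2) * (3 * b\<^sup>2 + c\<^sup>2) * (3 * b\<^sup>2 + a\<^sup>2) * (3 * c\<^sup>2 + a\<^sup>2) * (3 * c\<^sup>2 + b\<^sup>2) *
      (3 * a\<^sup>2 + b\<^sup>2) = 144 * q ^ 6 + 204 * q ^ 3 * r\<^sup>2 + 343 * r ^ 4"
    unfolding q_def r_def c_eq by algebra
  also have "6 ^ 6 * (144 * q ^ 6 + 204 * q ^ 3 * r\<^sup>2 + 343 * r ^ 4) \<ge> 6 ^ 6 * (144 * q ^ 6)"
    using \<open>0 < q\<close> by simp
  finally show ?thesis by (simp add: sqnorm_eq power_mult_distrib)
qed

interpretation sqnorm: expanding_height "\<lambda>w. real_of_int (sqnorm w)" 6 3 "9/4"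
proof
  fix w assume w: "edge_weights w"
  have "real_of_int (9 * (6 * sqnorm w) ^ 6) \<le> of_int (4 * (\<Prod>v\<leftarrow>orderings w. sqnorm (refine v)))"
    using prod_sqnorm_refine_ge[OF w] by (simp only: of_int_le_iff)
  moreover have "real_of_int (\<Prod>v\<leftarrow>orderings w. sqnorm (refine v)) =
      (\<Prod>v\<leftarrow>orderings w. real_of_int (sqnorm (refine v)))"
    by (cases w) (simp del: refine.simps sqnorm.simps)
  ultimately show
    "9/4 * (6 * real_of_int (sqnorm w)) ^ 6 \<le> (\<Prod>v\<leftarrow>orderings w. real_of_int (sqnorm (refine v)))"
    by simp
next
  fix w assume w: "edge_weights w"
  show "6 * real_of_int (sqnorm w) \<le> 3 * real_of_int (sqnorm (refine w))"
    "real_of_int (sqnorm (refine w)) \<le> 3 * (6 * real_of_int (sqnorm w))"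
    using sqnorm_refine_ge[OF w] sqnorm_refine_le[OF w] sqnorm_pos[OF w] by linarith+
qed (auto simp: sqnorm_pos sqnorm_ordering)

section \<open>The projective height\<close>

fun coeff_gcd :: "weights \<Rightarrow> int" where
  "coeff_gcd (a, b, c) = gcd a (gcd b c)"

definition proj_height :: "weights \<Rightarrow> real" where
  "proj_height w = real_of_int (sqnorm w) / (real_of_int (coeff_gcd w))\<^sup>2"

fun scale_weights :: "int \<Rightarrow> weights \<Rightarrow> weights" where
  "scale_weights d (a, b, c) = (d * a, d * b, d * c)"

lemma coeff_gcd_ordering: "v \<in> set (orderings w) \<Longrightarrow> coeff_gcd v = coeff_gcd w"
  by (cases w) (auto simp: gcd.commute gcd.left_commute)

lemma coeff_gcd_dvd:
  "coeff_gcd (a, b, c) dvd a" "coeff_gcd (a, b, c) dvd b" "coeff_gcd (a, b, c) dvd c"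
  unfolding coeff_gcd.simps by (blast intro: gcd_dvd1 gcd_dvd2 dvd_trans)+

lemma coeff_gcd_pos: "edge_weights w \<Longrightarrow> 0 < coeff_gcd w"
  by (cases w) auto

lemma coeff_gcd_scale_weights: "coeff_gcd (scale_weights d w) = \<bar>d\<bar> * coeff_gcd w"
  by (cases w; cases "0 \<le> d") (simp_all flip: gcd_mult_distrib_int)

lemma sqnorm_scale_weights: "sqnorm (scale_weights d w) = d\<^sup>2 * sqnorm w"
  by (cases w) (simp add: power_mult_distrib distrib_left)

lemma refine_scale_weights: "refine (scale_weights d w) = scale_weights d (refine w)"
  by (cases w) (simp add: algebra_simps)

lemma orderings_scale_weights: "orderings (scale_weights d w) = map (scale_weights d) (orderings w)"
  by (cases w) simp

lemma proj_height_pos: "edge_weights w \<Longrightarrow> 0 < proj_height w"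
  using sqnorm_pos[of w] coeff_gcd_pos[of w] by (simp add: proj_height_def)

lemma proj_height_ordering: "v \<in> set (orderings w) \<Longrightarrow> proj_height v = proj_height w"
  by (simp add: proj_height_def sqnorm_ordering coeff_gcd_ordering)

lemma proj_height_scale_weights: "d \<noteq> 0 \<Longrightarrow> proj_height (scale_weights d w) = proj_height w"
  by (simp add: proj_height_def coeff_gcd_scale_weights sqnorm_scale_weights power_mult_distrib)

lemma primitive_edge_weights:
  assumes "edge_weights w"
  obtains d v where "d \<noteq> 0" "edge_weights v" "coeff_gcd v = 1" "w = scale_weights d v"
proof -
  obtain a b c where w_eq: "w = (a, b, c)" by (cases w)
  define d where "d = coeff_gcd w"
  have "d dvd a" "d dvd b" "d dvd c" unfolding d_def w_eq by (rule coeff_gcd_dvd)+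
  then obtain x y z where w_scale: "w = scale_weights d (x, y, z)"
    by (auto simp: w_eq elim!: dvdE)
  have "0 < d" using coeff_gcd_pos[OF assms] by (simp add: d_def)
  have "d = \<bar>d\<bar> * coeff_gcd (x, y, z)"
    by (metis coeff_gcd_scale_weights d_def w_scale)
  then have "coeff_gcd (x, y, z) = 1" using \<open>0 < d\<close> by simp
  moreover have "d * (x + y + z) = 0" "(x, y, z) \<noteq> (0, 0, 0)"
    using assms by (auto simp: w_scale algebra_simps)
  then have "edge_weights (x, y, z)" using \<open>0 < d\<close> by simp
  ultimately show thesis using \<open>0 < d\<close> w_scale by (intro that[of d "(x, y, z)"]) simp_all
qed

lemma coprime_of_coeff_gcd_eq_1:
  assumes "edge_weights (a, b, c)" "coeff_gcd (a, b, c) = 1"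
  shows "coprime a b" "coprime b c" "coprime a c"
proof -
  have coprime: "coprime x y" if "x + y + z = 0" "coeff_gcd (x, y, z) = 1" for x y z
  proof (rule coprimeI)
    fix k assume "k dvd x" "k dvd y"
    moreover have "z = - x - y" using that(1) by simp
    ultimately have "k dvd coeff_gcd (x, y, z)" by simp
    then show "is_unit k" by (simp only: that(2))
  qed
  have "a + b + c = 0" "b + c + a = 0" "a + c + b = 0"
    using assms(1) by simp_all
  moreover have "coeff_gcd (b, c, a) = 1" "coeff_gcd (a, c, b) = 1"
    using assms(2) coeff_gcd_ordering[of "(b, c, a)" "(a, b, c)"]
      coeff_gcd_ordering[of "(a, c, b)" "(a, b, c)"] by simp_all
  ultimately show "coprime a b" "coprime b c" "coprime a c"
    using assms(2) by (blast intro: coprime)+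
qed

lemma dvd_gcd_mult:
  fixes a b k :: "'a :: semiring_gcd"
  assumes "e dvd a * k" "e dvd b * k"
  shows "e dvd gcd a b * k"
proof -
  have "e dvd gcd (a * k) (b * k)" using assms by (rule gcd_greatest)
  then show ?thesis by (simp only: gcd_mult_right dvd_normalize_iff gcd.commute)
qed

lemma prod_gcd_dvd:
  fixes a b c k :: "'a :: semiring_gcd"
  assumes "coprime a b" "coprime b c" "coprime a c"
  shows "gcd a k * gcd b k * gcd c k dvd k"
proof -
  have "coprime (gcd x k) (gcd y k)" if "coprime x y" for x y
    using gcd_dvd1 gcd_dvd1 that by (rule coprime_divisors)
  then show ?thesis using assms by (intro divides_mult) auto
qed

lemma coeff_gcd_refine_dvd:
  assumes "coprime b c"
  shows "coeff_gcd (refine (a, b, c)) dvd gcd b 2 * gcd c 3"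
proof -
  define e where "e = coeff_gcd (refine (a, b, c))"
  have "e dvd 3 * b + 2 * c" and dvd_2c: "e dvd 2 * c"
    unfolding e_def refine.simps by (rule coeff_gcd_dvd)+
  then have dvd_3b: "e dvd 3 * b" using dvd_add_left_iff by blast
  have "e dvd b * c"
    using dvd_diff[OF dvd_mult2[OF dvd_3b, of c] dvd_mult2[OF dvd_2c, of b]] by (simp add: mult_ac)
  then have "e dvd gcd b 2 * c" using dvd_2c by (rule dvd_gcd_mult)
  moreover have "e dvd gcd b 2 * 3"
  proof (rule dvd_gcd_mult)
    show "e dvd b * 3" using dvd_3b by (simp add: mult.commute)
    have "e dvd gcd b c * 6"
      using dvd_mult2[OF dvd_3b, of 2] dvd_mult2[OF dvd_2c, of 3]
      by (intro dvd_gcd_mult) (simp_all add: mult_ac)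
    then show "e dvd 2 * 3" using assms by simp
  qed
  ultimately have "e dvd gcd c 3 * gcd b 2"
    by (intro dvd_gcd_mult) (simp_all add: mult.commute)
  then show ?thesis by (simp add: e_def mult.commute)
qed

lemma coeff_gcd_refine_le:
  assumes "edge_weights w" "coeff_gcd w = 1"
  shows "coeff_gcd (refine w) \<le> 6"
proof -
  obtain a b c where w_eq: "w = (a, b, c)" by (cases w)
  have "coeff_gcd (refine w) dvd gcd b 2 * gcd c 3"
    using coprime_of_coeff_gcd_eq_1(2) assms unfolding w_eq by (intro coeff_gcd_refine_dvd)
  also have "\<dots> dvd 2 * 3" by (intro mult_dvd_mono gcd_dvd2)
  finally show ?thesis using zdvd_imp_le[of _ 6] by simp
qed

lemma prod_coeff_gcd_refine_le:
  assumes "edge_weights w" "coeff_gcd w = 1"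
  shows "(\<Prod>v\<leftarrow>orderings w. coeff_gcd (refine v)) \<le> 36"
proof -
  obtain a b c where w_eq: "w = (a, b, c)" by (cases w)
  have coprimes: "coprime a b" "coprime b c" "coprime a c"
    using coprime_of_coeff_gcd_eq_1 assms unfolding w_eq by blast+
  let ?g = "\<lambda>k. gcd a k * gcd b k * gcd c k"
  have "(\<Prod>v\<leftarrow>orderings w. coeff_gcd (refine v)) dvd
      (gcd b 2 * gcd c 3) * ((gcd a 2 * gcd c 3) * ((gcd c 2 * gcd a 3) * ((gcd b 2 * gcd a 3) *
        ((gcd a 2 * gcd b 3) * (gcd c 2 * gcd b 3)))))"
    unfolding w_eq orderings.simps list.map prod_list.Cons prod_list.Nil mult_1_right
    by (intro mult_dvd_mono coeff_gcd_refine_dvd) (simp_all only: coprimes coprime_commute)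
  also have "\<dots> = (?g 2)\<^sup>2 * (?g 3)\<^sup>2"
    by (simp only: power2_eq_square mult_ac)
  also have "\<dots> dvd 2\<^sup>2 * 3\<^sup>2"
    by (intro mult_dvd_mono dvd_power_same prod_gcd_dvd coprimes)
  finally show ?thesis using zdvd_imp_le[of _ 36] by simp
qed

lemma proj_height_refine_bounds:
  assumes "edge_weights w"
  shows "proj_height w \<le> 18 * proj_height (refine w)" "proj_height (refine w) \<le> 18 * proj_height w"
proof -
  obtain d v where d: "d \<noteq> 0" and v: "edge_weights v" "coeff_gcd v = 1"
    and w_eq: "w = scale_weights d v"
    using assms by (rule primitive_edge_weights)
  define N where "N = real_of_int (sqnorm v)"
  define M where "M = real_of_int (sqnorm (refine v))"
  define e where "e = real_of_int (coeff_gcd (refine v))"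
  have "1 \<le> e" "e \<le> 6"
    using coeff_gcd_pos[OF edge_weights_refine[OF v(1)]] coeff_gcd_refine_le[OF v]
    unfolding e_def by linarith+
  then have e_bounds: "0 < e" "1 \<le> e\<^sup>2" "e\<^sup>2 \<le> 36" using power_mono[of e 6 2] by auto
  have N_pos: "0 < N" and M_bounds: "2 * N \<le> M" "M \<le> 18 * N"
    using sqnorm.height_pos[OF v(1)] sqnorm.height_refine_ge[OF v(1)] sqnorm.height_refine_le[OF v(1)]
    by (simp_all add: N_def M_def)
  have heights: "proj_height w = N" "proj_height (refine w) = M / e\<^sup>2"
    unfolding w_eq refine_scale_weights proj_height_scale_weights[OF d]
    by (simp_all add: proj_height_def v(2) N_def M_def e_def)
  have "N * e\<^sup>2 \<le> N * 36" using N_pos e_bounds by (intro mult_left_mono) auto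
  then have "N * e\<^sup>2 \<le> 18 * M" using M_bounds(1) by linarith
  then show "proj_height w \<le> 18 * proj_height (refine w)"
    using e_bounds unfolding heights by (simp add: le_divide_eq)
  have "18 * N * 1 \<le> 18 * N * e\<^sup>2" using N_pos e_bounds by (intro mult_left_mono) auto
  then have "M \<le> 18 * N * e\<^sup>2" using M_bounds(2) by linarith
  then show "proj_height (refine w) \<le> 18 * proj_height w"
    using e_bounds unfolding heights by (simp add: divide_le_eq)
qed

lemma prod_proj_height_refine_ge:
  assumes "edge_weights w"
  shows "81 * proj_height w ^ 6 \<le> (\<Prod>u\<leftarrow>orderings w. proj_height (refine u))"
proof -
  obtain d v where d: "d \<noteq> 0" and v: "edge_weights v" "coeff_gcd v = 1"
    and w_eq: "w = scale_weights d v"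
    using assms by (rule primitive_edge_weights)
  define N where "N = real_of_int (sqnorm v)"
  define e where "e = (\<Prod>u\<leftarrow>orderings v. coeff_gcd (refine u))"
  have "0 < coeff_gcd (refine u)" if "u \<in> set (orderings v)" for u
    using edge_weights_ordering[OF v(1) that] by (intro coeff_gcd_pos edge_weights_refine)
  then have "0 < e"
    unfolding e_def by (cases v) (simp del: coeff_gcd.simps refine.simps)
  moreover have "e \<le> 36"
    unfolding e_def using v by (rule prod_coeff_gcd_refine_le)
  ultimately have e_bounds: "0 < real_of_int e" "(real_of_int e)\<^sup>2 \<le> 36\<^sup>2"
    using power_mono[of "real_of_int e" 36 2] by auto
  have "81 * N ^ 6 * (real_of_int e)\<^sup>2 \<le> 81 * N ^ 6 * 36\<^sup>2"
    using e_bounds by (intro mult_left_mono) auto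
  also have "\<dots> = 9/4 * (6 * N) ^ 6"
    by (simp add: power_mult_distrib)
  also have "\<dots> \<le> (\<Prod>u\<leftarrow>orderings v. real_of_int (sqnorm (refine u)))"
    using sqnorm.prod_height_refine_ge[OF v(1)] by (simp add: N_def)
  finally have
    "81 * N ^ 6 \<le> (\<Prod>u\<leftarrow>orderings v. real_of_int (sqnorm (refine u))) / (real_of_int e)\<^sup>2"
    using e_bounds by (simp add: le_divide_eq)
  also have "\<dots> = (\<Prod>u\<leftarrow>orderings v. proj_height (refine u))"
    by (cases v) (simp add: e_def proj_height_def power_mult_distrib
        del: coeff_gcd.simps sqnorm.simps refine.simps)
  also have "\<dots> = (\<Prod>u\<leftarrow>orderings w. proj_height (refine u))"
    by (simp add: w_eq orderings_scale_weights o_def refine_scale_weights proj_height_scale_weights d)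
  also have "N = proj_height w"
    unfolding w_eq proj_height_scale_weights[OF d] by (simp add: proj_height_def v(2) N_def)
  finally show ?thesis .
qed

interpretation proj_height: expanding_height proj_height 1 18 81
  by unfold_locales
    (simp_all add: proj_height_pos proj_height_ordering proj_height_refine_bounds
      prod_proj_height_refine_ge)

lemma proj_height_eq_of_lin_comb_eq_0:
  assumes nondeg: "nondeg_triangle T" and v: "edge_weights v" "lin_comb v T = 0"
    and w: "edge_weights w" "lin_comb w T = 0"
  shows "proj_height v = proj_height w"
proof -
  obtain A B C where T_eq: "T = (A, B, C)" by (cases T)
  obtain a b c x y z where vw_eq: "v = (a, b, c)" "w = (x, y, z)" by (cases v; cases w)
  have c_eq: "c = - a - b" and z_eq: "z = - x - y" using v w by (auto simp: vw_eq)
  have "of_int a * (A - C) + of_int b * (B - C) = 0" "of_int x * (A - C) + of_int y * (B - C) = 0"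
    using v w by (auto simp: T_eq vw_eq c_eq z_eq algebra_simps)
  then have "of_int (a * y - b * x) * (A - C) = 0" "of_int (a * y - b * x) * (B - C) = 0"
    by (simp_all, algebra+)
  moreover have "A - C \<noteq> 0 \<or> B - C \<noteq> 0" using nondeg by (auto simp: T_eq nondeg_triangle_def)
  ultimately have det_eq_0: "a * y = b * x" by (auto simp del: of_int_mult of_int_diff)
  obtain m n where "m \<noteq> 0" "n \<noteq> 0" "scale_weights m v = scale_weights n w"
  proof (cases "a = 0")
    case True
    then have "b \<noteq> 0" "x = 0" "y \<noteq> 0" using v(1) w(1) det_eq_0 by (auto simp: vw_eq)
    then show thesis using True by (intro that[of y b]) (simp_all add: vw_eq c_eq z_eq)
  next
    case False
    then have "x \<noteq> 0" using w(1) det_eq_0 by (auto simp: vw_eq)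
    then show thesis
      using False det_eq_0 by (intro that[of x a]) (simp_all add: vw_eq c_eq z_eq algebra_simps)
  qed
  then show ?thesis by (metis proj_height_scale_weights)
qed

lemma proj_height_bounded_of_lin_comb_eq_0:
  assumes "nondeg_triangle T"
  obtains L where "0 < L" "\<And>v. edge_weights v \<Longrightarrow> lin_comb v T = 0 \<Longrightarrow> proj_height v \<le> L"
proof (cases "\<exists>v. edge_weights v \<and> lin_comb v T = 0")
  case True
  then show thesis
    using that proj_height_pos proj_height_eq_of_lin_comb_eq_0[OF assms] by (metis order_refl)
next
  case False
  then show thesis using that[of 1] by (meson zero_less_one)
qed

section \<open>Areas and short edges\<close>

fun dbl_area :: "triangle \<Rightarrow> real" where
  "dbl_area (A, B, C) = \<bar>Im (cnj (B - A) * (C - A))\<bar>"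

lemma dbl_area_nonneg: "0 \<le> dbl_area T"
  by (cases T) simp

lemma dbl_area_ordering: "U \<in> set (orderings T) \<Longrightarrow> dbl_area U = dbl_area T"
  by (cases T) (auto simp: algebra_simps abs_if)

lemma dbl_area_first_child: "dbl_area (first_child T) = dbl_area T / 6"
proof -
  obtain A B C where T_eq: "T = (A, B, C)" by (cases T)
  have "Im (cnj ((A + B) / 2 - A) * ((A + B + C) / 3 - A)) = Im (cnj (B - A) * (C - A)) / 6"
    by (simp add: field_simps)
  then show ?thesis by (simp only: T_eq first_child.simps dbl_area.simps abs_divide abs_numeral)
qed

lemma nondeg_triangle_ordering: "U \<in> set (orderings T) \<Longrightarrow> nondeg_triangle U \<longleftrightarrow> nondeg_triangle T"
  by (cases T) (auto simp: nondeg_triangle_def)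

lemma nondeg_triangle_first_child:
  assumes "nondeg_triangle T"
  shows "nondeg_triangle (first_child T)"
proof -
  obtain A B C where T_eq: "T = (A, B, C)" by (cases T)
  have "A = B \<and> B = C" if "A = (A + B) / 2" "(A + B) / 2 = (A + B + C) / 3"
  proof -
    have "A = B" using that(1) by (simp add: field_simps)
    then show ?thesis using that(2) by (simp add: field_simps)
  qed
  then show ?thesis using assms unfolding T_eq nondeg_triangle_def by auto
qed

lemma
  assumes "i < 6"
  shows dbl_area_bary_child: "dbl_area (bary_child T i) = dbl_area T / 6"
    and nondeg_triangle_bary_child: "nondeg_triangle T \<Longrightarrow> nondeg_triangle (bary_child T i)"
proof -
  note child = bary_child_ordering[OF assms, of T]
  have parent: "orderings T ! i \<in> set (orderings T)" using assms by simp
  show "dbl_area (bary_child T i) = dbl_area T / 6"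
    using dbl_area_ordering[OF child] dbl_area_ordering[OF parent]
    by (simp add: dbl_area_first_child)
  show "nondeg_triangle (bary_child T i)" if "nondeg_triangle T"
    using nondeg_triangle_ordering[OF child] nondeg_triangle_ordering[OF parent]
      nondeg_triangle_first_child that by blast
qed

lemma
  assumes "U \<in> set_pmf (tri_chain T n)"
  shows dbl_area_tri_chain: "dbl_area U = dbl_area T / 6 ^ n"
    and nondeg_triangle_tri_chain: "nondeg_triangle T \<Longrightarrow> nondeg_triangle U"
proof -
  have "dbl_area U = dbl_area T / 6 ^ n \<and> (nondeg_triangle T \<longrightarrow> nondeg_triangle U)"
    using assms
  proof (induction n arbitrary: U)
    case (Suc n)
    then obtain S i where "S \<in> set_pmf (tri_chain T n)" "i < 6" "U = bary_child S i"
      by (auto simp: bary_step_def)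
    then show ?case
      using Suc.IH[of S] by (simp add: dbl_area_bary_child nondeg_triangle_bary_child)
  qed simp
  then show "dbl_area U = dbl_area T / 6 ^ n" "nondeg_triangle T \<Longrightarrow> nondeg_triangle U"
    by simp_all
qed

lemma sum_squares_le_cmod_lin_comb:
  assumes "Im (cnj u * v) \<noteq> 0"
  obtains k :: real where "0 < k"
    "\<And>s t. k * (s\<^sup>2 + t\<^sup>2) \<le> (cmod (of_real s * u + of_real t * v))\<^sup>2"
proof -
  define f where "f p = of_real (fst p) * u + of_real (snd p) * v" for p
  have linear: "linear f"
    by (rule linearI) (simp_all add: f_def algebra_simps scaleR_conv_of_real)
  have "p = 0" if "f p = 0" for p
  proof -
    have "fst p * Im (cnj u * v) = Im (cnj (f p) * v)" "snd p * Im (cnj u * v) = Im (cnj u * f p)"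
      by (simp_all add: f_def algebra_simps)
    then show ?thesis using assms that by (simp add: prod_eq_iff)
  qed
  then have "inj f" using linear by (simp add: linear_injective_0)
  then obtain k where k: "0 < k" "\<And>p. k * norm p \<le> norm (f p)"
    using linear_inj_bounded_below_pos[OF linear] by blast
  show thesis
  proof (rule that[of "k\<^sup>2"])
    show "0 < k\<^sup>2" using k(1) by simp
    fix s t :: real
    have "k\<^sup>2 * (s\<^sup>2 + t\<^sup>2) = (k * norm (s, t))\<^sup>2"
      by (simp add: norm_Pair power_mult_distrib)
    also have "\<dots> \<le> (norm (f (s, t)))\<^sup>2"
      using k by (intro power_mono) auto
    finally show "k\<^sup>2 * (s\<^sup>2 + t\<^sup>2) \<le> (cmod (of_real s * u + of_real t * v))\<^sup>2"
      by (simp add: f_def)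
  qed
qed

lemma sqnorm_le_cmod_lin_comb:
  assumes "dbl_area T \<noteq> 0"
  obtains k :: real where "0 < k"
    "\<And>w. edge_weights w \<Longrightarrow> k * real_of_int (sqnorm w) \<le> (cmod (lin_comb w T))\<^sup>2"
proof -
  obtain A B C where T_eq: "T = (A, B, C)" by (cases T)
  have "Im (cnj (B - A) * (C - A)) \<noteq> 0" using assms by (simp add: T_eq)
  then obtain k where k: "0 < k"
    "\<And>s t. k * (s\<^sup>2 + t\<^sup>2) \<le> (cmod (of_real s * (B - A) + of_real t * (C - A)))\<^sup>2"
    by (rule sum_squares_le_cmod_lin_comb) blast
  show thesis
  proof (rule that[of "k / 3"])
    show "0 < k / 3" using k(1) by simp
    fix w assume "edge_weights w"
    then obtain a b c where w_eq: "w = (a, b, c)" and a_eq: "a = - b - c" by (cases w) auto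
    have "real_of_int (sqnorm w) = 3 * ((of_int b)\<^sup>2 + (of_int c)\<^sup>2) - (of_int b - of_int c)\<^sup>2"
      by (simp add: w_eq a_eq power2_eq_square algebra_simps)
    then have "real_of_int (sqnorm w) / 3 \<le> (of_int b)\<^sup>2 + (of_int c)\<^sup>2" by simp
    then have "k * (real_of_int (sqnorm w) / 3) \<le> k * ((of_int b)\<^sup>2 + (of_int c)\<^sup>2)"
      by (rule mult_left_mono) (use k(1) in simp)
    then have "k / 3 * real_of_int (sqnorm w) \<le> k * ((of_int b)\<^sup>2 + (of_int c)\<^sup>2)"
      by (simp only: times_divide_eq_left times_divide_eq_right)
    also have "\<dots> \<le> (cmod (of_real (of_int b) * (B - A) + of_real (of_int c) * (C - A)))\<^sup>2"
      by (rule k(2))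
    also have "of_real (of_int b) * (B - A) + of_real (of_int c) * (C - A) = lin_comb w T"
      by (simp add: w_eq T_eq a_eq algebra_simps)
    finally show "k / 3 * real_of_int (sqnorm w) \<le> (cmod (lin_comb w T))\<^sup>2" .
  qed
qed

definition has_short_edge :: "real \<Rightarrow> triangle \<Rightarrow> bool" where
  "has_short_edge \<kappa> T \<longleftrightarrow> (\<exists>(P, Q, R)\<in>set (orderings T). (dist P R)\<^sup>2 \<le> \<kappa> * dbl_area T)"

lemma has_short_edge_tri_chain:
  assumes "U \<in> set_pmf (tri_chain T n)" "has_short_edge \<kappa> U"
  shows "\<exists>S\<in>set (orderings U). (cmod (6 ^ n * lin_comb (1, 0, - 1) S))\<^sup>2 \<le> \<kappa> * 6 ^ n * dbl_area T"
proof -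
  obtain P Q R where ordering: "(P, Q, R) \<in> set (orderings U)"
    and short: "(dist P R)\<^sup>2 \<le> \<kappa> * dbl_area U"
    using assms(2) by (auto simp: has_short_edge_def)
  have "(cmod (6 ^ n * lin_comb (1, 0, - 1) (P, Q, R)))\<^sup>2 = 6 ^ n * (6 ^ n * (dist P R)\<^sup>2)"
    by (simp add: dist_norm norm_mult norm_power power2_eq_square)
  also have "\<dots> \<le> 6 ^ n * (6 ^ n * (\<kappa> * dbl_area U))"
    using short by (intro mult_left_mono) auto
  also have "\<dots> = \<kappa> * 6 ^ n * dbl_area T"
    by (simp add: dbl_area_tri_chain[OF assms(1)])
  finally show ?thesis using ordering by blast
qed

lemma prob_has_short_edge_tendsto_zero:
  assumes nondeg: "nondeg_triangle T" and "0 < \<kappa>"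
  shows "(\<lambda>n. measure_pmf.prob (tri_chain T n) {U. has_short_edge \<kappa> U}) \<longlonglongrightarrow> 0"
proof (rule prob_tendsto_zero_mono_on_support)
  define B where "B n = {z. (cmod z)\<^sup>2 \<le> \<kappa> * 6 ^ n * dbl_area T}" for n
  show "{U. has_short_edge \<kappa> U} \<inter> set_pmf (tri_chain T n)
      \<subseteq> {U. \<exists>S\<in>set (orderings U). 6 ^ n * lin_comb (1, 0, - 1) S \<in> B n}" for n
    using has_short_edge_tri_chain unfolding B_def by blast
  show "(\<lambda>n. measure_pmf.prob (tri_chain T n)
      {U. \<exists>S\<in>set (orderings U). 6 ^ n * lin_comb (1, 0, - 1) S \<in> B n}) \<longlonglongrightarrow> 0"
  proof (cases "dbl_area T = 0")
    case True
    obtain L where L: "0 < L" "\<And>v. edge_weights v \<Longrightarrow> lin_comb v T = 0 \<Longrightarrow> proj_height v \<le> L"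
      using nondeg by (rule proj_height_bounded_of_lin_comb_eq_0) blast
    show ?thesis
      using L True by (intro proj_height.prob_lin_comb_tendsto_zero[where L = L]) (auto simp: B_def)
  next
    case False
    obtain k where k: "0 < k"
        "\<And>v. edge_weights v \<Longrightarrow> k * real_of_int (sqnorm v) \<le> (cmod (lin_comb v T))\<^sup>2"
      using False by (rule sqnorm_le_cmod_lin_comb) blast
    show ?thesis
    proof (rule sqnorm.prob_lin_comb_tendsto_zero[where L = "\<kappa> * dbl_area T / k"])
      show "0 < \<kappa> * dbl_area T / k" using False \<open>0 < \<kappa>\<close> k(1) dbl_area_nonneg[of T] by simp
      fix n v assume "edge_weights v" "lin_comb v T \<in> B n"
      then have "k * real_of_int (sqnorm v) \<le> \<kappa> * 6 ^ n * dbl_area T"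
        using k(2)[of v] by (simp add: B_def)
      then show "real_of_int (sqnorm v) \<le> \<kappa> * dbl_area T / k * 6 ^ n"
        using k(1) by (simp add: le_divide_eq mult_ac)
    qed simp
  qed
qed

section \<open>Characterizing points and largest angles\<close>

lemma similitude_dist:
  assumes "similitude f"
  obtains k where "0 < k" "\<And>x y. dist (f x) (f y) = k * dist x y"
proof -
  obtain a b where a: "a \<noteq> 0" and "(\<forall>z. f z = a * z + b) \<or> (\<forall>z. f z = a * cnj z + b)"
    using assms by (auto simp: similitude_def)
  then have "(\<forall>x y. f x - f y = a * (x - y)) \<or> (\<forall>x y. f x - f y = a * cnj (x - y))"
    by (auto simp: algebra_simps)
  then have "dist (f x) (f y) = cmod a * dist x y" for x y
    unfolding dist_norm by (metis complex_mod_cnj norm_mult)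
  then show thesis using that[of "cmod a"] a by simp
qed

lemma vertex_angle_eq_dist:
  "vertex_angle v u w =
    arccos (((dist u v)\<^sup>2 + (dist w v)\<^sup>2 - (dist u w)\<^sup>2) / (2 * dist u v * dist w v))"
proof -
  have "(u - v) \<bullet> (w - v) = ((dist u v)\<^sup>2 + (dist w v)\<^sup>2 - (dist u w)\<^sup>2) / 2"
    using dot_norm_neg[of "u - v" "w - v"] by (simp add: dist_norm)
  then show ?thesis unfolding vertex_angle_def by (simp only:) (simp add: dist_norm mult.assoc)
qed

lemma vertex_angle_similitude:
  assumes "similitude f"
  shows "vertex_angle (f v) (f u) (f w) = vertex_angle v u w"
proof -
  obtain k where "0 < k" "\<And>x y. dist (f x) (f y) = k * dist x y"
    using assms by (rule similitude_dist) blast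
  moreover have "((k * x)\<^sup>2 + (k * y)\<^sup>2 - (k * z)\<^sup>2) / (2 * (k * x) * (k * y)) =
      (x\<^sup>2 + y\<^sup>2 - z\<^sup>2) / (2 * x * y)"
    if "0 < k" for x y z k :: real
  proof -
    have "((k * x)\<^sup>2 + (k * y)\<^sup>2 - (k * z)\<^sup>2) / (2 * (k * x) * (k * y)) =
        k\<^sup>2 * (x\<^sup>2 + y\<^sup>2 - z\<^sup>2) / (k\<^sup>2 * (2 * x * y))"
      by (simp add: power2_eq_square algebra_simps)
    also have "\<dots> = (x\<^sup>2 + y\<^sup>2 - z\<^sup>2) / (2 * x * y)"
      using that by (intro mult_divide_mult_cancel_left) simp
    finally show ?thesis .
  qed
  ultimately show ?thesis by (simp only: vertex_angle_eq_dist)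
qed

fun sides :: "triangle \<Rightarrow> real list" where
  "sides (P, Q, R) = [dist P R, dist Q R, dist P Q]"

lemma mset_sides_ordering: "S \<in> set (orderings T) \<Longrightarrow> mset (sides S) = mset (sides T)"
  by (cases T) (auto simp: dist_commute)

lemma sides_eq_sort:
  assumes "S \<in> set (orderings T)" "sorted (sides S)"
  shows "sides S = sort (sides T)"
  using mset_sides_ordering[OF assms(1)] assms(2) by (simp add: properties_for_sort)

lemma exists_sorted_ordering: "\<exists>S\<in>set (orderings T). sorted (sides S)"
proof -
  obtain A B C where T_eq: "T = (A, B, C)" by (cases T)
  show ?thesis
    unfolding T_eq by (simp add: dist_commute) linarith
qed

lemma distinct_of_sorted_sides:
  assumes "nondeg_triangle T" "(P, Q, R) \<in> set (orderings T)" "sorted (sides (P, Q, R))"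
  shows "P \<noteq> Q"
proof
  assume "P = Q"
  then have "dist Q R = 0" using assms(3) zero_le_dist[of Q R] by simp
  with \<open>P = Q\<close> have "\<not> nondeg_triangle (P, Q, R)" by (simp add: nondeg_triangle_def)
  then show False using assms nondeg_triangle_ordering by blast
qed

lemma normalizing_similitude:
  assumes "P \<noteq> Q"
  obtains f where "similitude f" "f P = 0" "f Q = 1" "0 \<le> Im (f R)"
proof -
  define g where "g z = (z - P) / (Q - P)" for z
  have g_normalized: "g P = 0" "g Q = 1" using assms by (simp_all add: g_def)
  have affine: "g z = 1 / (Q - P) * z + - P / (Q - P)" for z
    by (simp add: g_def diff_divide_distrib)
  show thesis
  proof (cases "0 \<le> Im (g R)")
    case True
    moreover have "similitude g"
      using affine assms unfolding similitude_def
      by (metis divide_eq_0_iff right_minus_eq zero_neq_one)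
    ultimately show thesis using g_normalized by (intro that)
  next
    case False
    have "cnj (g z) = cnj (1 / (Q - P)) * cnj z + cnj (- P / (Q - P))" for z
      by (simp add: affine)
    then have "similitude (\<lambda>z. cnj (g z))"
      unfolding similitude_def using assms
      by (intro exI[of _ "cnj (1 / (Q - P))"] exI[of _ "cnj (- P / (Q - P))"]) simp
    then show thesis using g_normalized False by (intro that[of "\<lambda>z. cnj (g z)"]) simp_all
  qed
qed

lemma cmod_similitude_image:
  assumes "similitude f" "f P = 0" "f Q = 1"
  shows "cmod (f R) = dist P R / dist P Q" "cmod (f R - 1) = dist Q R / dist P Q"
proof -
  obtain k where k: "0 < k" "\<And>x y. dist (f x) (f y) = k * dist x y"
    using assms(1) by (rule similitude_dist) blast
  have "k * dist P Q = 1" using k(2)[of P Q] assms by simp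
  then have "k = 1 / dist P Q" by (metis mult_zero_right nonzero_eq_divide_eq zero_neq_one)
  then show "cmod (f R) = dist P R / dist P Q" "cmod (f R - 1) = dist Q R / dist P Q"
    using k(2)[of R P] k(2)[of R Q] assms by (simp_all add: dist_norm norm_minus_commute)
qed

lemma Re_between_0_and_half:
  assumes "cmod p \<le> cmod (p - 1)" "cmod (p - 1) \<le> 1"
  shows "0 \<le> Re p" "Re p \<le> 1/2"
proof -
  have "(cmod p)\<^sup>2 \<le> (cmod (p - 1))\<^sup>2" "(cmod (p - 1))\<^sup>2 \<le> 1"
    using assms by (auto intro: power_mono simp: power_le_one)
  then have "(Re p)\<^sup>2 + (Im p)\<^sup>2 \<le> (Re p - 1)\<^sup>2 + (Im p)\<^sup>2" "(Re p - 1)\<^sup>2 + (Im p)\<^sup>2 \<le> 1"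
    by (simp_all add: cmod_power2)
  then show "Re p \<le> 1/2" and "0 \<le> Re p"
    by (simp_all add: power2_eq_square algebra_simps) (smt (verit) zero_le_square)
qed

lemma is_char_point_iff:
  "is_char_point T p \<longleftrightarrow> 0 \<le> Im p \<and> (\<exists>P Q R f. (P, Q, R) \<in> set (orderings T) \<and>
     sorted (sides (P, Q, R)) \<and> similitude f \<and> f P = 0 \<and> f Q = 1 \<and> f R = p)"
  (is "_ \<longleftrightarrow> ?normalized")
proof -
  have ordering: "(case T of (A, B, C) \<Rightarrow>
      (P, Q, R) \<in> {(A, B, C), (A, C, B), (B, A, C), (B, C, A), (C, A, B), (C, B, A)})
    \<longleftrightarrow> (P, Q, R) \<in> set (orderings T)" for P Q R
    by (cases T) auto
  have sorted: "sorted (sides (P, Q, R)) \<longleftrightarrow> dist P Q \<ge> dist Q R \<and> dist Q R \<ge> dist P R" for P Q R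
    by auto
  have "0 \<le> Re p \<and> Re p \<le> 1/2" if normalized: ?normalized
  proof -
    obtain P Q R f where sides: "sorted (sides (P, Q, R))"
      and f: "similitude f" "f P = 0" "f Q = 1" "f R = p"
      using normalized by blast
    have "dist P R / dist P Q \<le> dist Q R / dist P Q" "dist Q R / dist P Q \<le> 1"
      using sides by (auto intro: divide_right_mono simp: divide_le_eq_1)
    then have "cmod p \<le> cmod (p - 1)" "cmod (p - 1) \<le> 1"
      using cmod_similitude_image[OF f(1-3), of R] f(4) by simp_all
    then show ?thesis using Re_between_0_and_half by blast
  qed
  then show ?thesis
    unfolding is_char_point_def ordering sorted by blast
qed

lemma ex_is_char_point:
  assumes "nondeg_triangle T"
  shows "\<exists>p. is_char_point T p"
proof -
  obtain P Q R where sorted: "(P, Q, R) \<in> set (orderings T)" "sorted (sides (P, Q, R))"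
    using exists_sorted_ordering by (metis prod_cases3)
  obtain f where "similitude f" "f P = 0" "f Q = 1" "0 \<le> Im (f R)"
    using distinct_of_sorted_sides[OF assms sorted] by (rule normalizing_similitude)
  then show ?thesis using sorted is_char_point_iff by blast
qed

lemma is_char_point_unique:
  assumes "is_char_point T p" "is_char_point T q"
  shows "p = q"
proof -
  have side_ratios: "cmod z = sort (sides T) ! 0 / sort (sides T) ! 2 \<and>
      cmod (z - 1) = sort (sides T) ! 1 / sort (sides T) ! 2 \<and> 0 \<le> Im z" if "is_char_point T z" for z
  proof -
    obtain P Q R f where sorted: "(P, Q, R) \<in> set (orderings T)" "sorted (sides (P, Q, R))"
      and f: "similitude f" "f P = 0" "f Q = 1" "f R = z" and Im_z: "0 \<le> Im z"
      using \<open>is_char_point T z\<close> unfolding is_char_point_iff by blast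
    show ?thesis
      using cmod_similitude_image[OF f(1-3), of R] f(4) Im_z
      by (simp flip: sides_eq_sort[OF sorted] add: eval_nat_numeral)
  qed
  have "(cmod p)\<^sup>2 = (cmod q)\<^sup>2" "(cmod (p - 1))\<^sup>2 = (cmod (q - 1))\<^sup>2"
    and Im_nonneg: "0 \<le> Im p" "0 \<le> Im q"
    using side_ratios[OF assms(1)] side_ratios[OF assms(2)] by simp_all
  then have "(Re p)\<^sup>2 + (Im p)\<^sup>2 = (Re q)\<^sup>2 + (Im q)\<^sup>2"
    "(Re p - 1)\<^sup>2 + (Im p)\<^sup>2 = (Re q - 1)\<^sup>2 + (Im q)\<^sup>2"
    by (simp_all add: cmod_power2)
  then have "Re p = Re q" "(Im p)\<^sup>2 = (Im q)\<^sup>2"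
    by (simp_all add: power2_eq_square algebra_simps)
  then show "p = q" using Im_nonneg by (simp add: complex_eq_iff)
qed

lemma largest_angle_eq_vertex_angle:
  assumes "nondeg_triangle T"
  obtains P Q R where "(P, Q, R) \<in> set (orderings T)" "sorted (sides (P, Q, R))"
    "largest_angle T = vertex_angle R P Q"
proof -
  have "is_char_point T (char_point T)"
    unfolding char_point_def using ex_is_char_point[OF assms] is_char_point_unique by (metis theI')
  then obtain P Q R f where sorted: "(P, Q, R) \<in> set (orderings T)" "sorted (sides (P, Q, R))"
    and f: "similitude f" "f P = 0" "f Q = 1" "f R = char_point T"
    unfolding is_char_point_iff by blast
  have "largest_angle T = vertex_angle R P Q"
    unfolding largest_angle_def using vertex_angle_similitude[OF f(1), of R P Q] f(2-4) by simp
  then show thesis using sorted that by blast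
qed

lemma abs_inner_divide_norms_le_1:
  fixes x y :: "'a :: real_inner"
  shows "\<bar>x \<bullet> y / (norm x * norm y)\<bar> \<le> 1"
  using Cauchy_Schwarz_ineq2[of x y] by (cases "x = 0 \<or> y = 0") (auto simp: abs_divide divide_le_eq_1)

lemma cos_vertex_angle: "norm (u - v) * norm (w - v) * cos (vertex_angle v u w) = (u - v) \<bullet> (w - v)"
  unfolding vertex_angle_def cos_arccos_abs[OF abs_inner_divide_norms_le_1]
  by (cases "u = v \<or> w = v") auto

lemma vertex_angle_bounded: "0 \<le> vertex_angle v u w" "vertex_angle v u w \<le> pi"
  using abs_inner_divide_norms_le_1[of "u - v" "w - v"]
  unfolding vertex_angle_def abs_le_iff by (auto intro: arccos_lbound arccos_ubound)

lemma dbl_area_eq_sin_vertex_angle: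
  "dbl_area (A, B, C) = dist A B * dist A C * sin (vertex_angle A B C)"
proof (rule power2_eq_imp_eq)
  let ?n = "norm (B - A) * norm (C - A)" and ?\<theta> = "vertex_angle A B C"
  have "(dbl_area (A, B, C))\<^sup>2 = ?n\<^sup>2 - ((B - A) \<bullet> (C - A))\<^sup>2"
    by (simp add: power_mult_distrib cmod_power2 inner_complex_def)
      (simp add: power2_eq_square algebra_simps)
  also have "\<dots> = ?n\<^sup>2 * (1 - (cos ?\<theta>)\<^sup>2)"
    by (simp only: cos_vertex_angle[symmetric] power_mult_distrib right_diff_distrib mult_1_right)
  also have "\<dots> = (?n * sin ?\<theta>)\<^sup>2"
    by (simp add: sin_squared_eq power_mult_distrib)
  finally show "(dbl_area (A, B, C))\<^sup>2 = (dist A B * dist A C * sin ?\<theta>)\<^sup>2"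
    by (simp add: dist_norm norm_minus_commute)
qed (simp_all add: dbl_area_nonneg sin_ge_zero vertex_angle_bounded)

text \<open>If \<open>P = R\<close>, the convention \<open>x / 0 = 0\<close> makes the angle equal to \<open>\<pi> / 2\<close>.\<close>

lemma pi_third_le_vertex_angle:
  assumes "dist P R \<le> dist Q R" "dist Q R \<le> dist P Q"
  shows "pi / 3 \<le> vertex_angle R P Q"
proof -
  define x y z where "x = dist P R" and "y = dist Q R" and "z = dist P Q"
  have triangle: "0 \<le> x" "x \<le> y" "y \<le> z" "z \<le> x + y"
    using assms dist_triangle2[of P Q R] by (auto simp: x_def y_def z_def)
  have "x * x \<le> x * y" "y\<^sup>2 \<le> z\<^sup>2" "z\<^sup>2 \<le> (x + y)\<^sup>2"
    using triangle by (auto intro: mult_left_mono power_mono)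
  then have "- (2 * x * y) \<le> x\<^sup>2 + y\<^sup>2 - z\<^sup>2" "x\<^sup>2 + y\<^sup>2 - z\<^sup>2 \<le> x * y"
    by (simp_all add: power2_eq_square algebra_simps)
  moreover have "0 \<le> x * y" using triangle by simp
  ultimately have "- 1 \<le> (x\<^sup>2 + y\<^sup>2 - z\<^sup>2) / (2 * x * y)" "(x\<^sup>2 + y\<^sup>2 - z\<^sup>2) / (2 * x * y) \<le> 1/2"
    by (simp_all add: le_divide_eq divide_le_eq)
  then have "arccos (1/2) \<le> arccos ((x\<^sup>2 + y\<^sup>2 - z\<^sup>2) / (2 * x * y))"
    by (intro arccos_le_arccos) simp_all
  also have "arccos (1/2) = pi / 3"
    using arccos_cos[of "pi / 3"] by (simp add: cos_60)
  finally show ?thesis by (simp add: vertex_angle_eq_dist x_def y_def z_def)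
qed

lemma sin_le_sin_between_supplements:
  fixes x y :: real
  assumes "0 \<le> x" "x \<le> y" "y \<le> pi - x"
  shows "sin x \<le> sin y"
proof (cases "y \<le> pi / 2")
  case True
  then show ?thesis using assms by (intro sin_monotone_2pi_le) auto
next
  case False
  then have "sin x \<le> sin (pi - y)" using assms by (intro sin_monotone_2pi_le) auto
  then show ?thesis by simp
qed

lemma has_short_edge_of_largest_angle_less:
  fixes \<epsilon> :: real
  assumes "0 < \<epsilon>"
  obtains \<kappa> where "0 < \<kappa>"
    "\<And>T. nondeg_triangle T \<Longrightarrow> largest_angle T < pi - \<epsilon> \<Longrightarrow> has_short_edge \<kappa> T"
proof -
  define \<eta> where "\<eta> = min \<epsilon> (pi / 3)"
  have \<eta>: "0 < \<eta>" "\<eta> \<le> \<epsilon>" "\<eta> \<le> pi / 3" using assms by (auto simp: \<eta>_def)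
  have sin_pos: "0 < sin \<eta>" using \<eta> by (intro sin_gt_zero) auto
  show thesis
  proof (rule that[of "1 / sin \<eta>"])
    show "0 < 1 / sin \<eta>" using sin_pos by simp
    fix T assume T: "nondeg_triangle T" "largest_angle T < pi - \<epsilon>"
    obtain P Q R where sorted: "(P, Q, R) \<in> set (orderings T)" "sorted (sides (P, Q, R))"
      and angle: "largest_angle T = vertex_angle R P Q"
      using T(1) by (rule largest_angle_eq_vertex_angle)
    have dists: "dist P R \<le> dist Q R" "dist Q R \<le> dist P Q" using sorted(2) by simp_all
    have "sin \<eta> \<le> sin (vertex_angle R P Q)"
      using \<eta> pi_third_le_vertex_angle[OF dists] T(2) angle
      by (intro sin_le_sin_between_supplements) auto
    then have "(dist P R)\<^sup>2 * sin \<eta> \<le> dist R P * dist R Q * sin (vertex_angle R P Q)"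
      using dists(1) sin_pos unfolding power2_eq_square by (intro mult_mono) (auto simp: dist_commute)
    also have "\<dots> = dbl_area (R, P, Q)"
      by (rule dbl_area_eq_sin_vertex_angle[symmetric])
    also have "\<dots> = dbl_area T"
      using dbl_area_ordering[OF sorted(1)] dbl_area_ordering[of "(R, P, Q)" "(P, Q, R)"] by simp
    finally have "(dist P R)\<^sup>2 \<le> 1 / sin \<eta> * dbl_area T"
      using sin_pos by (simp add: le_divide_eq)
    then show "has_short_edge (1 / sin \<eta>) T"
      using sorted(1) by (auto simp: has_short_edge_def)
  qed
qed

theorem theorem2:
  fixes T0 :: triangle and \<epsilon> :: real
  assumes "nondeg_triangle T0" and "\<epsilon> > 0"
  shows "(\<lambda>n. measure_pmf.prob (tri_chain T0 n) {T. largest_angle T < pi - \<epsilon>})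
           \<longlonglongrightarrow> 0"
proof -
  obtain \<kappa> where "0 < \<kappa>"
    and short: "\<And>T. nondeg_triangle T \<Longrightarrow> largest_angle T < pi - \<epsilon> \<Longrightarrow> has_short_edge \<kappa> T"
    using assms(2) by (rule has_short_edge_of_largest_angle_less) blast
  show ?thesis
  proof (rule prob_tendsto_zero_mono_on_support)
    show "(\<lambda>n. measure_pmf.prob (tri_chain T0 n) {T. has_short_edge \<kappa> T}) \<longlonglongrightarrow> 0"
      using assms(1) \<open>0 < \<kappa>\<close> by (rule prob_has_short_edge_tendsto_zero)
    show "{T. largest_angle T < pi - \<epsilon>} \<inter> set_pmf (tri_chain T0 n) \<subseteq> {T. has_short_edge \<kappa> T}" for n
      using short nondeg_triangle_tri_chain assms(1) by blast
  qed
qed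

end
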